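(* If $A\in\mathbb{Z}^{d_A\times n_A}$, $B\in\mathbb{Z}^{d_A\times n_B}$, $C\in\mathbb{Z}^{d_C\times n_B}$, $D\in\mathbb{Z}^{d_C\times n_A}$ are fixed matrices, then \[ \max\left\{\|\mathbf{v}\|_1:\mathbf{v}\in\mathcal{G}\left(\left(\begin{smallmatrix} C & D \\ B & A \end{smallmatrix}\right)^{(N)}\right)\right\} \] is bounded by a polynomial in $N$; that is, there is a polynomial $p$ depending only on $A,B,C,D$ such that for every $N\in\mathbb{Z}_+$ this maximum is at most $p(N)$.
   Context: For a matrix $E\in\mathbb{Z}^{d\times n}$, the Graver basis $\mathcal{G}(E)$ is the (finite) set of all nonzero vectors $\mathbf{v}\in\ker(E)\cap\mathbb{Z}^n$ that cannot be written as a sum $\mathbf{v}=\mathbf{v}'+\mathbf{v}''$ of nonzero vectors $\mathbf{v}',\mathbf{v}''\in\ker(E)\cap\mathbb{Z}^n$ lying in the same orthant as $\mathbf{v}$ (i.e. $v'_iv''_i\ge 0$ for all $i$). The maximum over an empty set is taken to be $0$. For $N\in\mathbb{Z}_+$, the $N$-fold $4$-block matrix is the $(d_C+Nd_A)\times(n_B+Nn_A)$ matrix \[ \left(\begin{smallmatrix} C & D \\ B & A \end{smallmatrix}\right)^{(N)}:= \begin{pmatrix} C & D & D & \cdots & D \\ B & A & 0 & & 0 \\ B & 0 & A & & 0 \\ \vdots & & & \ddots & \\ B & 0 & 0 & & A \end{pmatrix} \] with $N$ copies of $A$. *)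

theory Defs
  imports "Jordan_Normal_Form.Matrix_Kernel" "HOL-Computational_Algebra.Polynomial"
begin

text \<open>All matrices and vectors have integer entries, so \<^const>\<open>mat_kernel\<close> is the set of
  integer points of the kernel.\<close>

definition graver_basis :: "int mat \<Rightarrow> int vec set" where
  "graver_basis E = {v \<in> mat_kernel E. v \<noteq> 0\<^sub>v (dim_col E) \<and>
     \<not> (\<exists>v'\<in>mat_kernel E. \<exists>v''\<in>mat_kernel E.
          v' \<noteq> 0\<^sub>v (dim_col E) \<and> v'' \<noteq> 0\<^sub>v (dim_col E) \<and>
          (\<forall>i<dim_col E. 0 \<le> v' $ i * v'' $ i) \<and> v = v' + v'')}"

definition l1_norm :: "int vec \<Rightarrow> int" where
  "l1_norm v = (\<Sum>i<dim_vec v. \<bar>v $ i\<bar>)"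

text \<open>This maximum ranges over a finite set, see \<open>finite_graver_basis\<close> below.\<close>

definition max_graver_norm :: "int mat \<Rightarrow> int" where
  "max_graver_norm E =
     (if graver_basis E = {} then 0 else Max (l1_norm ` graver_basis E))"

definition repeat_cols :: "nat \<Rightarrow> 'a mat \<Rightarrow> 'a mat" where
  "repeat_cols N D = mat (dim_row D) (N * dim_col D) (\<lambda>(i, j). D $$ (i, j mod dim_col D))"

definition repeat_rows :: "nat \<Rightarrow> 'a mat \<Rightarrow> 'a mat" where
  "repeat_rows N B = mat (N * dim_row B) (dim_col B) (\<lambda>(i, j). B $$ (i mod dim_row B, j))"

text \<open>The argument order follows the two rows \<open>C D\<close> and \<open>B A\<close> of the block display.
  For \<open>N = 0\<close> the result is \<open>C\<close>.\<close>

definition nfold_four_block ::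
    "'a::zero mat \<Rightarrow> 'a mat \<Rightarrow> 'a mat \<Rightarrow> 'a mat \<Rightarrow> nat \<Rightarrow> 'a mat" where
  "nfold_four_block C D B A N =
     four_block_mat C (repeat_cols N D) (repeat_rows N B) (diag_block_mat (replicate N A))"

lemma nfold_four_block_carrier:
  assumes "A \<in> carrier_mat dA nA" "C \<in> carrier_mat dC nB"
  shows "nfold_four_block C D B A N \<in> carrier_mat (dC + N * dA) (nB + N * nA)"
  using assms
  by (auto simp: nfold_four_block_def four_block_mat_def Let_def dim_diag_block_mat
      sum_list_replicate)

lemma nat_seq_incseq_subseq:
  fixes x :: "nat \<Rightarrow> nat"
  shows "\<exists>r. strict_mono r \<and> incseq (\<lambda>n. x (r n))"
proof -
  obtain r where r: "strict_mono r" "monoseq (\<lambda>n. x (r n))"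
    using seq_monosub[of x] by (auto simp: strict_mono_def)
  show ?thesis
  proof (cases "incseq (\<lambda>n. x (r n))")
    case True
    then show ?thesis using r(1) by blast
  next
    case False
    then have dec: "decseq (\<lambda>n. x (r n))" using r(2) by (simp add: monoseq_iff)
    obtain k where k: "\<And>m. x (r k) \<le> x (r m)"
      using ex_has_least_nat[of "\<lambda>_. True" 0 "\<lambda>n. x (r n)"] by blast
    have "x (r (k + m)) = x (r k)" for m
      using k[of "k + m"] decseqD[OF dec, of k "k + m"] by simp
    then have "incseq (\<lambda>n. x (r (k + n)))" by (simp add: incseq_def)
    moreover have "strict_mono (\<lambda>n. r (k + n))"
      using r(1) by (simp add: strict_mono_def)
    ultimately show ?thesis by blast
  qed
qed

lemma dickson_incseq_subseq:
  fixes f :: "nat \<Rightarrow> 'b \<Rightarrow> nat"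
  assumes "finite I"
  shows "\<exists>r. strict_mono r \<and> (\<forall>i\<in>I. incseq (\<lambda>n. f (r n) i))"
  using assms
proof (induction I)
  case empty
  then show ?case using strict_mono_id by auto
next
  case (insert a I)
  then obtain r where r: "strict_mono r" "\<forall>i\<in>I. incseq (\<lambda>n. f (r n) i)" by blast
  obtain s where s: "strict_mono s" "incseq (\<lambda>n. f (r (s n)) a)"
    using nat_seq_incseq_subseq[of "\<lambda>n. f (r n) a"] by blast
  have "strict_mono (\<lambda>n. r (s n))" using r(1) s(1) by (simp add: strict_mono_def)
  moreover have "incseq (\<lambda>n. f (r (s n)) i)" if "i \<in> I" for i
    using that r(2) strict_mono_mono[OF s(1)] by (auto simp: incseq_def mono_def)
  ultimately show ?case using s(2) by (intro exI[of _ "\<lambda>n. r (s n)"]) auto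
qed

lemma finite_graver_basis: "finite (graver_basis E)"
proof (rule ccontr)
  assume "infinite (graver_basis E)"
  then obtain v :: "nat \<Rightarrow> int vec" where v: "inj v" "range v \<subseteq> graver_basis E"
    using infinite_countable_subset by blast
  define n where "n = dim_col E"
  define f where "f k j = (if snd j then nat (v k $ fst j) else nat (- (v k $ fst j)))"
    for k :: nat and j :: "nat \<times> bool"
  obtain r where r: "strict_mono r" "\<forall>j\<in>{..<n} \<times> UNIV. incseq (\<lambda>k. f (r k) j)"
    using dickson_incseq_subseq[of "{..<n} \<times> UNIV" f] by auto
  define u where "u = v (r 0)"
  define w where "w = v (r 1)"
  have "r 0 \<noteq> r 1" using strict_monoD[OF r(1), of 0 1] by simp
  then have uw: "u \<noteq> w" using v(1) by (auto simp: u_def w_def inj_eq)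
  have ug: "u \<in> graver_basis E" and wg: "w \<in> graver_basis E"
    using v(2) by (auto simp: u_def w_def)
  have E: "E \<in> carrier_mat (dim_row E) n" by (simp add: n_def)
  have u: "u \<in> carrier_vec n" "E *\<^sub>v u = 0\<^sub>v (dim_row E)"
    and w: "w \<in> carrier_vec n" "E *\<^sub>v w = 0\<^sub>v (dim_row E)"
    using ug wg by (auto simp: graver_basis_def mat_kernel_def n_def)
  have le: "nat (u $ i) \<le> nat (w $ i)" "nat (- u $ i) \<le> nat (- w $ i)" if "i < n" for i
  proof -
    have "f (r 0) (i, b) \<le> f (r 1) (i, b)" for b
      using r(2) that by (auto simp: incseq_def)
    from this[of True] this[of False]
    show "nat (u $ i) \<le> nat (w $ i)" "nat (- u $ i) \<le> nat (- w $ i)"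
      by (auto simp: f_def u_def w_def)
  qed
  have "0 \<le> u $ i * (w - u) $ i" if "i < n" for i
  proof -
    have "0 \<le> u $ i * (w $ i - u $ i)"
      using le[OF that] by (cases "0 \<le> u $ i") (auto simp: zero_le_mult_iff)
    then show ?thesis using u(1) w(1) that by simp
  qed
  moreover have "w - u \<in> mat_kernel E"
  proof (rule mat_kernelI[OF E])
    show "w - u \<in> carrier_vec n" using u(1) w(1) by simp
    have "E *\<^sub>v (w - u) = E *\<^sub>v w - E *\<^sub>v u"
      by (rule mult_minus_distrib_mat_vec[OF E w(1) u(1)])
    also have "\<dots> = 0\<^sub>v (dim_row E)" unfolding u(2) w(2) by (intro eq_vecI) simp_all
    finally show "E *\<^sub>v (w - u) = 0\<^sub>v (dim_row E)" .
  qed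
  moreover have weq: "w = u + (w - u)" using u(1) w(1) by (intro eq_vecI) auto
  moreover have "w - u \<noteq> 0\<^sub>v n"
  proof
    assume "w - u = 0\<^sub>v n"
    with weq have "w = u + 0\<^sub>v n" by metis
    then show False using uw right_zero_vec[OF u(1)] by simp
  qed
  moreover have "u \<in> mat_kernel E" "u \<noteq> 0\<^sub>v n"
    using ug by (auto simp: graver_basis_def n_def)
  ultimately show False using wg unfolding graver_basis_def n_def mem_Collect_eq by metis
qed

end

theory Submission
  imports Defs "HOL-Library.Ramsey"
begin

text \<open>
  First ignore the rows \<open>C D \<dots> D\<close>. By Ramsey's theorem, among any infinitely many \<open>x\<close>
  there are \<open>x \<noteq> x'\<close> such that every \<open>(x', y)\<close> in the kernel of \<open>(B A)\<close> conformally dominates some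
  \<open>(x, y')\<close> in it. Doing this in all \<open>N\<close> blocks at once shows that only finitely many heads \<open>x\<close>
  occur in Graver elements, uniformly in \<open>N\<close>, and then by Dickson's lemma only finitely many
  blocks. The Graver norm of this part is therefore linear in \<open>N\<close>.

  Then add the upper rows one at a time. An element of the new kernel is a conformal sum of old
  Graver elements. Ordering the summands so that the partial sums have bounded scalar product
  with the new row, two equal values would give a proper conformal summand. Hence a norm bound \<open>K\<close>
  becomes \<open>K (2 M K + 1)\<close>, where \<open>M\<close> bounds the row entries, and polynomial bounds stay polynomial.
\<close>

section \<open>Conformal order and the 1-norm\<close>

text \<open>This is the usual sign-compatible order: same orthant, no larger absolute value in any
  coordinate. It is phrased by linear inequalities, not products of signs, so that coordinatewise
  claims reduce to linear arithmetic.\<close>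

definition conformal :: "int vec \<Rightarrow> int vec \<Rightarrow> bool" (infix "\<unlhd>" 50) where
  "u \<unlhd> v \<longleftrightarrow> dim_vec u = dim_vec v \<and>
     (\<forall>i<dim_vec v. 0 \<le> u $ i \<and> u $ i \<le> v $ i \<or> v $ i \<le> u $ i \<and> u $ i \<le> 0)"

lemma conformal_refl: "u \<unlhd> u"
  by (auto simp: conformal_def)

lemma conformal_dim: "u \<unlhd> v \<Longrightarrow> dim_vec u = dim_vec v"
  by (simp add: conformal_def)

lemma conformalD:
  "u \<unlhd> v \<Longrightarrow> i < dim_vec v \<Longrightarrow> 0 \<le> u $ i \<and> u $ i \<le> v $ i \<or> v $ i \<le> u $ i \<and> u $ i \<le> 0"
  by (simp add: conformal_def)

lemma conformalI:
  assumes "dim_vec u = dim_vec v"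
    and "\<And>i. i < dim_vec v \<Longrightarrow> 0 \<le> u $ i \<and> u $ i \<le> v $ i \<or> v $ i \<le> u $ i \<and> u $ i \<le> 0"
  shows "u \<unlhd> v"
  using assms by (simp add: conformal_def)

lemma conformal_trans:
  assumes "u \<unlhd> v" "v \<unlhd> w"
  shows "u \<unlhd> w"
proof (rule conformalI)
  show d: "dim_vec u = dim_vec w" using assms by (simp add: conformal_dim)
  fix i assume i: "i < dim_vec w"
  show "0 \<le> u $ i \<and> u $ i \<le> w $ i \<or> w $ i \<le> u $ i \<and> u $ i \<le> 0"
    using conformalD[OF assms(1), of i] conformalD[OF assms(2) i] i conformal_dim[OF assms(2)]
    by linarith
qed

lemma conformal_carrier: "u \<unlhd> v \<Longrightarrow> v \<in> carrier_vec n \<Longrightarrow> u \<in> carrier_vec n"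
  by (rule carrier_vecI) (metis conformal_dim carrier_vecD)

lemma conformal_zero: "v \<in> carrier_vec n \<Longrightarrow> 0\<^sub>v n \<unlhd> v"
  by (rule conformalI) auto

lemma conformal_diff:
  assumes "u \<unlhd> v"
  shows "v - u \<unlhd> v"
proof (rule conformalI)
  show "dim_vec (v - u) = dim_vec v" using assms by (simp add: conformal_dim)
  fix i assume i: "i < dim_vec v"
  then have "(v - u) $ i = v $ i - u $ i" using conformal_dim[OF assms] by simp
  then show "0 \<le> (v - u) $ i \<and> (v - u) $ i \<le> v $ i \<or> v $ i \<le> (v - u) $ i \<and> (v - u) $ i \<le> 0"
    using conformalD[OF assms i] by linarith
qed

lemma conformal_diff_left: "u \<unlhd> v \<Longrightarrow> v \<unlhd> w \<Longrightarrow> v - u \<unlhd> w"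
  using conformal_diff conformal_trans by blast

text \<open>Each coordinate of \<open>v - u\<close> has the sign of \<open>v\<close>, so adding a
  conformal part \<open>g\<close> of it moves \<open>u\<close> towards \<open>v\<close> without
  overshooting. This lets a conformal sum be built up one summand at a time.\<close>

lemma conformal_add:
  assumes "u \<unlhd> v" "g \<unlhd> v - u"
  shows "u + g \<unlhd> v" "u \<unlhd> u + g"
proof -
  have d: "dim_vec u = dim_vec v" "dim_vec g = dim_vec v"
    using conformal_dim[OF assms(1)] conformal_dim[OF assms(2)] by simp_all
  have diff: "0 \<le> g $ i \<and> g $ i \<le> v $ i - u $ i \<or> v $ i - u $ i \<le> g $ i \<and> g $ i \<le> 0"
    if "i < dim_vec v" for i
    using conformalD[OF assms(2), of i] that d by simp
  show "u + g \<unlhd> v"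
  proof (rule conformalI)
    show "dim_vec (u + g) = dim_vec v" using d by simp
    fix i assume i: "i < dim_vec v"
    then have "(u + g) $ i = u $ i + g $ i" using d by simp
    then show "0 \<le> (u + g) $ i \<and> (u + g) $ i \<le> v $ i \<or> v $ i \<le> (u + g) $ i \<and> (u + g) $ i \<le> 0"
      using diff[OF i] conformalD[OF assms(1) i] by linarith
  qed
  show "u \<unlhd> u + g"
  proof (rule conformalI)
    show "dim_vec u = dim_vec (u + g)" using d by simp
    fix i assume "i < dim_vec (u + g)"
    then have i: "i < dim_vec v" and "(u + g) $ i = u $ i + g $ i" using d by simp_all
    then show "0 \<le> u $ i \<and> u $ i \<le> (u + g) $ i \<or> (u + g) $ i \<le> u $ i \<and> u $ i \<le> 0"
      using diff[OF i] conformalD[OF assms(1) i] by linarith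
  qed
qed

lemma l1_norm_nonneg: "0 \<le> l1_norm v"
  by (simp add: l1_norm_def sum_nonneg)

lemma l1_norm_zero [simp]: "l1_norm (0\<^sub>v n) = 0"
  by (simp add: l1_norm_def)

lemma l1_norm_pos: "v \<in> carrier_vec n \<Longrightarrow> v \<noteq> 0\<^sub>v n \<Longrightarrow> 0 < l1_norm v"
proof -
  assume v: "v \<in> carrier_vec n" "v \<noteq> 0\<^sub>v n"
  then obtain i where "i < n" "v $ i \<noteq> 0" by (metis eq_vecI carrier_vecD index_zero_vec)
  then show ?thesis unfolding l1_norm_def using v(1) by (intro sum_pos2[of _ i]) auto
qed

text \<open>No cancellation occurs between conformal vectors: \<open>\<bar>v $ i - u $ i\<bar> =
  \<bar>v $ i\<bar> - \<bar>u $ i\<bar>\<close> in every coordinate. All descent arguments below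
  measure progress by this identity.\<close>

lemma l1_norm_diff: "u \<unlhd> v \<Longrightarrow> l1_norm (v - u) = l1_norm v - l1_norm u"
proof -
  assume uv: "u \<unlhd> v"
  then have "l1_norm (v - u) = (\<Sum>i<dim_vec v. \<bar>v $ i\<bar> - \<bar>u $ i\<bar>)"
    unfolding l1_norm_def by (intro sum.cong) (auto simp: conformal_def)
  then show ?thesis using uv by (simp add: l1_norm_def conformal_def sum_subtractf)
qed

lemma abs_scalar_prod_le:
  fixes r v :: "int vec"
  assumes "dim_vec r = dim_vec v" "\<And>i. i < dim_vec v \<Longrightarrow> \<bar>r $ i\<bar> \<le> M"
  shows "\<bar>r \<bullet> v\<bar> \<le> M * l1_norm v"
proof -
  have "\<bar>r \<bullet> v\<bar> \<le> (\<Sum>i<dim_vec v. \<bar>r $ i * v $ i\<bar>)"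
    unfolding scalar_prod_def atLeast0LessThan by (rule sum_abs)
  also have "\<dots> \<le> (\<Sum>i<dim_vec v. M * \<bar>v $ i\<bar>)"
    using assms(2) by (intro sum_mono) (auto simp: abs_mult intro: mult_right_mono)
  finally show ?thesis by (simp add: l1_norm_def sum_distrib_left)
qed

section \<open>Kernels and their irreducible elements\<close>

text \<open>The kernel is indexed by a set of rows instead of a matrix, so that rows can be inserted
  one by one.\<close>

definition orth :: "nat \<Rightarrow> int vec set \<Rightarrow> int vec set" where
  "orth n R = {v \<in> carrier_vec n. \<forall>r\<in>R. r \<bullet> v = 0}"

text \<open>These are the minimal nonzero elements for the conformal order. The set \<open>L\<close>
  is arbitrary, so the notion applies to kernels and to sets described block by block.\<close>

definition irreducibles :: "nat \<Rightarrow> int vec set \<Rightarrow> int vec set" where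
  "irreducibles n L = {v \<in> L. v \<noteq> 0\<^sub>v n \<and> (\<forall>u\<in>L. u \<noteq> 0\<^sub>v n \<longrightarrow> u \<unlhd> v \<longrightarrow> u = v)}"

lemma scalar_prod_diff:
  fixes r :: "int vec"
  assumes "r \<in> carrier_vec n" "u \<in> carrier_vec n" "v \<in> carrier_vec n"
  shows "r \<bullet> (u - v) = r \<bullet> u - r \<bullet> v"
  using assms by (simp add: scalar_prod_minus_distrib)

lemma orth_add:
  assumes R: "R \<subseteq> carrier_vec n" and u: "u \<in> orth n R" and v: "v \<in> orth n R"
  shows "u + v \<in> orth n R"
proof -
  have c: "u \<in> carrier_vec n" "v \<in> carrier_vec n" using u v by (simp_all add: orth_def)
  have "r \<bullet> (u + v) = 0" if "r \<in> R" for r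
    using scalar_prod_add_distrib[OF subsetD[OF R that] c] that u v by (simp add: orth_def)
  then show ?thesis using c by (simp add: orth_def)
qed

lemma orth_diff:
  assumes R: "R \<subseteq> carrier_vec n" and u: "u \<in> orth n R" and v: "v \<in> orth n R"
  shows "u - v \<in> orth n R"
proof -
  have c: "u \<in> carrier_vec n" "v \<in> carrier_vec n" using u v by (simp_all add: orth_def)
  have "r \<bullet> (u - v) = 0" if "r \<in> R" for r
    using scalar_prod_diff[OF subsetD[OF R that] c] that u v by (simp add: orth_def)
  then show ?thesis using c by (simp add: orth_def)
qed

lemma conformal_eqI:
  assumes "u \<unlhd> v" "l1_norm v \<le> l1_norm u" "v \<in> carrier_vec n"
  shows "u = v"
proof -
  have u: "u \<in> carrier_vec n" using assms conformal_carrier by blast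
  have "v - u = 0\<^sub>v n"
    using l1_norm_pos[of "v - u" n] l1_norm_diff[OF assms(1)] assms(2) u assms(3) by force
  then have "(v - u) $ i = 0" if "i < n" for i using that by simp
  then show ?thesis using u assms(3) by (intro eq_vecI) auto
qed

text \<open>A nonzero kernel vector \<open>u \<noteq> v\<close> with \<open>u \<unlhd> v\<close>
  would give the forbidden decomposition \<open>v = u + (v - u)\<close>, whose two parts lie in the
  same orthant. Norm bounds for irreducibles thus carry over to Graver elements.\<close>

lemma graver_basis_subset_irreducibles:
  "graver_basis E \<subseteq> irreducibles (dim_col E) (orth (dim_col E) (set (rows E)))"
proof
  fix v assume v: "v \<in> graver_basis E"
  define n where "n = dim_col E"
  define L where "L = orth n (set (rows E))"
  have ker: "mat_kernel E = L"
  proof -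
    have "E *\<^sub>v x = 0\<^sub>v (dim_row E) \<longleftrightarrow> (\<forall>r\<in>set (rows E). r \<bullet> x = 0)" for x
    proof -
      have "E *\<^sub>v x = 0\<^sub>v (dim_row E) \<longleftrightarrow> (\<forall>i<dim_row E. row E i \<bullet> x = 0)"
        by (simp add: vec_eq_iff)
      also have "\<dots> \<longleftrightarrow> (\<forall>r\<in>set (rows E). r \<bullet> x = 0)"
        by (auto simp: rows_def)
      finally show ?thesis .
    qed
    then show ?thesis unfolding mat_kernel_def L_def orth_def n_def by simp
  qed
  have R: "set (rows E) \<subseteq> carrier_vec n" unfolding n_def by (rule rows_carrier)
  have vL: "v \<in> L" "v \<noteq> 0\<^sub>v n" using v unfolding graver_basis_def ker n_def by blast+
  have vn: "v \<in> carrier_vec n" using vL by (simp add: L_def orth_def)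
  have "u = v" if u: "u \<in> L" "u \<noteq> 0\<^sub>v n" "u \<unlhd> v" for u
  proof (rule ccontr)
    assume "u \<noteq> v"
    have un: "u \<in> carrier_vec n" using u by (simp add: L_def orth_def)
    have "v - u \<in> L" using orth_diff[OF R] vL u unfolding L_def by blast
    moreover have vu: "v = u + (v - u)" using un vn by (intro eq_vecI) auto
    moreover have "v - u \<noteq> 0\<^sub>v n" using vu \<open>u \<noteq> v\<close> un by (metis right_zero_vec)
    moreover have "\<forall>i<n. 0 \<le> u $ i * (v - u) $ i"
      using u(3) un vn by (auto simp: conformal_def zero_le_mult_iff)
    ultimately show False using v u unfolding graver_basis_def ker n_def mem_Collect_eq by metis
  qed
  then show "v \<in> irreducibles (dim_col E) (orth (dim_col E) (set (rows E)))"
    using vL unfolding irreducibles_def L_def n_def by blast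
qed

text \<open>Descent on \<open>l1_norm\<close>: a nonzero element that is not irreducible has a
  strictly shorter nonzero one conformally below it.\<close>

lemma ex_irreducible_conformal:
  assumes L: "L \<subseteq> carrier_vec n" and "v \<in> L" "v \<noteq> 0\<^sub>v n"
  shows "\<exists>g\<in>irreducibles n L. g \<unlhd> v"
  using assms(2,3)
proof (induction "nat (l1_norm v)" arbitrary: v rule: less_induct)
  case less
  show ?case
  proof (cases "v \<in> irreducibles n L")
    case True
    then show ?thesis using conformal_refl by blast
  next
    case False
    then obtain u where u: "u \<in> L" "u \<noteq> 0\<^sub>v n" "u \<unlhd> v" "u \<noteq> v"
      using less.prems by (auto simp: irreducibles_def)
    have "l1_norm u < l1_norm v"
      using conformal_eqI[OF u(3)] u(4) L less.prems(1) by (meson not_less subsetD)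
    then have "nat (l1_norm u) < nat (l1_norm v)" using l1_norm_nonneg[of u] by linarith
    from less.hyps[OF this u(1,2)] show ?thesis using conformal_trans u(3) by blast
  qed
qed

text \<open>In a conformal sum of irreducibles equal to \<open>v\<close>, the products with
  \<open>r\<close> add up to \<open>r \<bullet> v\<close>, so they cannot all have the strictly
  wrong sign. The induction strips off a summand of the wrong sign; the shorter remainder still
  satisfies the sign condition. The factor \<open>s\<close> covers both directions.\<close>

lemma ex_irreducible_conformal_sign:
  fixes s :: int
  assumes R: "R \<subseteq> carrier_vec n" and r: "r \<in> carrier_vec n"
    and "v \<in> orth n R" "v \<noteq> 0\<^sub>v n" "s * (r \<bullet> v) \<le> 0"
  shows "\<exists>g\<in>irreducibles n (orth n R). g \<unlhd> v \<and> s * (r \<bullet> g) \<le> 0"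
  using assms(3-)
proof (induction "nat (l1_norm v)" arbitrary: v rule: less_induct)
  case less
  have L: "orth n R \<subseteq> carrier_vec n" by (auto simp: orth_def)
  obtain g where g: "g \<in> irreducibles n (orth n R)" "g \<unlhd> v"
    using ex_irreducible_conformal[OF L less.prems(1,2)] by blast
  have gL: "g \<in> orth n R" "g \<noteq> 0\<^sub>v n" using g(1) unfolding irreducibles_def by blast+
  have gn: "g \<in> carrier_vec n" and vn: "v \<in> carrier_vec n" using gL less.prems(1) L by blast+
  show ?case
  proof (cases "s * (r \<bullet> g) \<le> 0")
    case True
    then show ?thesis using g by blast
  next
    case False
    have rd: "s * (r \<bullet> (v - g)) = s * (r \<bullet> v) - s * (r \<bullet> g)"
      by (simp add: scalar_prod_diff[OF r vn gn] right_diff_distrib)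
    \<comment> \<open>If nothing remained, \<open>s * (r \<bullet> v)\<close> would equal the
      positive number \<open>s * (r \<bullet> g)\<close>.\<close>
    have nz: "v - g \<noteq> 0\<^sub>v n"
    proof
      assume "v - g = 0\<^sub>v n"
      then have "r \<bullet> (v - g) = 0" using scalar_prod_right_zero[OF r] by metis
      then have "s * (r \<bullet> (v - g)) = 0" by (rule ssubst) (rule mult_zero_right)
      then show False using rd False less.prems(3) by linarith
    qed
    have "nat (l1_norm (v - g)) < nat (l1_norm v)"
      using l1_norm_diff[OF g(2)] l1_norm_pos[OF gn gL(2)] l1_norm_nonneg[of "v - g"] by linarith
    moreover have "v - g \<in> orth n R" using orth_diff[OF R less.prems(1) gL(1)] .
    moreover have "s * (r \<bullet> (v - g)) \<le> 0" using rd False less.prems(3) by linarith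
    ultimately have "\<exists>g'\<in>irreducibles n (orth n R). g' \<unlhd> v - g \<and> s * (r \<bullet> g') \<le> 0"
      using less.hyps nz by metis
    then show ?thesis using conformal_trans conformal_diff[OF g(2)] by metis
  qed
qed

section \<open>Effect of one additional row\<close>

text \<open>The vector \<open>v\<close> is reached from zero by adding irreducibles for
  \<open>R\<close>, each of norm at most \<open>K\<close>. The products of the partial sums with
  \<open>r\<close> stay in \<open>{- (M * K)..M * K}\<close> and never repeat, which leaves at most
  \<open>2 * M * K + 1\<close> steps.\<close>

lemma irreducible_norm_insert_row:
  fixes M K :: int
  assumes R: "R \<subseteq> carrier_vec n" and r: "r \<in> carrier_vec n"
    and M: "\<And>i. i < n \<Longrightarrow> \<bar>r $ i\<bar> \<le> M" "0 \<le> M" "0 \<le> K"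
    and K: "\<And>g. g \<in> irreducibles n (orth n R) \<Longrightarrow> l1_norm g \<le> K"
    and v: "v \<in> irreducibles n (orth n (insert r R))"
  shows "l1_norm v \<le> K * (2 * M * K + 1)"
proof -
  define L where "L = orth n R"
  define I where "I = {- (M * K)..M * K}"
  have L: "L \<subseteq> carrier_vec n" by (auto simp: orth_def L_def)
  have vL: "v \<in> L" and rv: "r \<bullet> v = 0" and vn: "v \<in> carrier_vec n"
    and vmin: "\<And>u. u \<in> L \<Longrightarrow> r \<bullet> u = 0 \<Longrightarrow> u \<noteq> 0\<^sub>v n \<Longrightarrow> u \<unlhd> v \<Longrightarrow> u = v"
    using v unfolding irreducibles_def orth_def L_def by blast+
  \<comment> \<open>\<open>W\<close> collects the nonzero points visited by a walk from \<open>0\<close> to \<open>w\<close>.\<close>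
  have walk: "\<exists>W. finite W \<and> (\<lambda>a. r \<bullet> a) ` W \<subseteq> I \<and> inj_on (\<lambda>a. r \<bullet> a) W \<and> l1_norm v \<le> K * card W"
    if "w \<in> L" "w \<unlhd> v" "r \<bullet> w \<in> I" "finite W" "(\<lambda>a. r \<bullet> a) ` W \<subseteq> I" "inj_on (\<lambda>a. r \<bullet> a) W"
      "l1_norm w \<le> K * card W" "\<And>a. a \<in> W \<Longrightarrow> a \<in> L \<and> a \<noteq> 0\<^sub>v n \<and> a \<unlhd> w" for w W
    using that
  proof (induction "nat (l1_norm v - l1_norm w)" arbitrary: w W rule: less_induct)
    case less
    note p = less.prems
    have wn: "w \<in> carrier_vec n" using p L by blast
    show ?case
    proof (cases "w = v")
      case True
      then show ?thesis using p by blast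
    next
      case False
      have vw0: "v - w \<noteq> 0\<^sub>v n"
      proof
        assume "v - w = 0\<^sub>v n"
        then have "l1_norm v \<le> l1_norm w" using l1_norm_diff[OF p(2)] by simp
        then show False using conformal_eqI[OF p(2) _ vn] False by blast
      qed
      have vwL: "v - w \<in> orth n R" using orth_diff[OF R] vL p(1) unfolding L_def by blast
      have rvw: "r \<bullet> (v - w) = - (r \<bullet> w)" using scalar_prod_diff[OF r vn wn] rv by simp
      \<comment> \<open>The next summand is chosen so that its product with \<open>r\<close> does
        not have the same strict sign as \<open>r \<bullet> w\<close>. As this product is at most
        \<open>M * K\<close> in absolute value, the walk cannot leave \<open>I\<close>.\<close>
      define s :: int where "s = (if r \<bullet> w > 0 then 1 else - 1)"
      have "s * (r \<bullet> (v - w)) \<le> 0" unfolding rvw s_def by auto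
      from ex_irreducible_conformal_sign[OF R r vwL vw0 this]
      obtain g where g: "g \<in> irreducibles n L" "g \<unlhd> v - w" "s * (r \<bullet> g) \<le> 0"
        unfolding L_def by blast
      have gL: "g \<in> L" "g \<noteq> 0\<^sub>v n" and gn: "g \<in> carrier_vec n"
        using g(1) L unfolding irreducibles_def by blast+
      have gK: "l1_norm g \<le> K" using K g(1) by (simp add: L_def)
      have "\<bar>r \<bullet> g\<bar> \<le> M * l1_norm g" using abs_scalar_prod_le[of r g M] M r gn by auto
      also have "\<dots> \<le> M * K" using gK M by (simp add: mult_left_mono)
      finally have rg: "\<bar>r \<bullet> g\<bar> \<le> M * K" .
      define w' where "w' = w + g"
      have rw': "r \<bullet> w' = r \<bullet> w + r \<bullet> g"
        unfolding w'_def by (rule scalar_prod_add_distrib[OF r wn gn])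
      have I': "r \<bullet> w' \<in> I"
        using p(3) g(3) rg unfolding rw' I_def s_def by (auto split: if_splits)
      have w'L: "w' \<in> L" unfolding w'_def L_def using orth_add[OF R] p(1) gL unfolding L_def by blast
      have w'n: "w' \<in> carrier_vec n" using w'L L by blast
      have w'v: "w' \<unlhd> v" unfolding w'_def by (rule conformal_add(1)[OF p(2) g(2)])
      have ww': "w \<unlhd> w'" unfolding w'_def by (rule conformal_add(2)[OF p(2) g(2)])
      have "w' - w = g" unfolding w'_def using wn gn by (intro eq_vecI) auto
      then have l1: "l1_norm w' = l1_norm w + l1_norm g" using l1_norm_diff[OF ww'] by simp
      have gpos: "0 < l1_norm g" using l1_norm_pos[OF gn gL(2)] .
      \<comment> \<open>Equal values put the nonzero vector \<open>w' - a\<close> into the new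
        kernel and conformally below \<open>v\<close>, so it is \<open>v\<close> itself; but it is
        shorter than \<open>w'\<close>, which is no longer than \<open>v\<close>. This needs
        \<open>a\<close> to be nonzero, and indeed the start \<open>0\<close> and the end
        \<open>v\<close> share the value \<open>0\<close>.\<close>
      have fresh: "r \<bullet> a \<noteq> r \<bullet> w'" if a: "a \<in> W" for a
      proof
        assume eq: "r \<bullet> a = r \<bullet> w'"
        have aL: "a \<in> L" "a \<noteq> 0\<^sub>v n" "a \<unlhd> w" using p(8) a by auto
        have an: "a \<in> carrier_vec n" using aL L by blast
        have aw': "a \<unlhd> w'" using conformal_trans aL(3) ww' by blast
        have "l1_norm a \<le> l1_norm w"
          using l1_norm_diff[OF aL(3)] l1_norm_nonneg[of "w - a"] by simp
        then have pos: "0 < l1_norm (w' - a)" using l1_norm_diff[OF aw'] l1 gpos by simp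
        then have "w' - a \<noteq> 0\<^sub>v n" by auto
        moreover have "w' - a \<in> L" using orth_diff[OF R] w'L aL(1) unfolding L_def by blast
        moreover have "r \<bullet> (w' - a) = 0" using scalar_prod_diff[OF r w'n an] eq by simp
        moreover have "w' - a \<unlhd> v" by (rule conformal_diff_left[OF aw' w'v])
        ultimately have "w' - a = v" using vmin by blast
        then have "l1_norm v = l1_norm w' - l1_norm a" using l1_norm_diff[OF aw'] by simp
        moreover have "l1_norm w' \<le> l1_norm v"
          using l1_norm_diff[OF w'v] l1_norm_nonneg[of "v - w'"] by simp
        ultimately show False using l1_norm_pos[OF an aL(2)] by linarith
      qed
      have card: "card (insert w' W) = Suc (card W)" using fresh p(4) by (subst card_insert_disjoint) auto
      have "l1_norm w' \<le> K * card (insert w' W)"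
        unfolding card l1 using p(7) gK by (simp add: algebra_simps)
      moreover have "nat (l1_norm v - l1_norm w') < nat (l1_norm v - l1_norm w)"
        using l1 gpos l1_norm_diff[OF w'v] l1_norm_nonneg[of "v - w'"] by linarith
      moreover have "inj_on (\<lambda>a. r \<bullet> a) (insert w' W)"
        using p(6) fresh by (auto simp: inj_on_def) metis+
      moreover have "w' \<noteq> 0\<^sub>v n" using l1 gpos l1_norm_nonneg[of w] by auto
      ultimately show ?thesis
        using less.hyps[of w' "insert w' W"] w'L w'v I' p(4,5) p(8) ww' conformal_refl conformal_trans
        by (metis (no_types, lifting) finite_insert image_insert insert_iff insert_subset)
    qed
  qed
  have z: "0\<^sub>v n \<in> L" using R by (auto simp: L_def orth_def subset_iff intro!: scalar_prod_right_zero)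
  have "\<exists>W. finite W \<and> (\<lambda>a. r \<bullet> a) ` W \<subseteq> I \<and> inj_on (\<lambda>a. r \<bullet> a) W \<and> l1_norm v \<le> K * card W"
    using z conformal_zero[OF vn] r M by (intro walk[of "0\<^sub>v n" "{}"]) (auto simp: I_def)
  then obtain W where W: "finite W" "(\<lambda>a. r \<bullet> a) ` W \<subseteq> I" "inj_on (\<lambda>a. r \<bullet> a) W"
    "l1_norm v \<le> K * card W" by blast
  have "card W = card ((\<lambda>a. r \<bullet> a) ` W)" using W(3) by (simp add: card_image)
  also have "\<dots> \<le> card I" using W(2) by (intro card_mono) (auto simp: I_def)
  finally have "int (card W) \<le> int (card I)" by simp
  also have "\<dots> = 2 * M * K + 1" using mult_nonneg_nonneg[OF M(3,2)] by (simp add: I_def)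
  finally have "int (card W) \<le> 2 * M * K + 1" .
  then have "K * card W \<le> K * (2 * M * K + 1)" using M(3) by (rule mult_left_mono)
  then show ?thesis using W(4) by linarith
qed

section \<open>Well-quasi-ordering of sets of vectors\<close>

text \<open>After splitting vectors into positive and negative parts, this says that monomial ideals
  are well-quasi-ordered by reverse inclusion (Maclagan's theorem). Whole sets are compared, so that
  every block of a long vector can later be replaced at once.\<close>

lemma sequence_of_sets_dominated:
  fixes S :: "nat \<Rightarrow> int vec set"
  assumes S: "\<And>k. S k \<subseteq> carrier_vec m"
  shows "\<exists>k l. k < l \<and> (\<forall>v\<in>S l. \<exists>u\<in>S k. u \<unlhd> v)"
proof (rule ccontr)
  assume "\<not> ?thesis"
  then have "\<forall>k l. \<exists>v. k < l \<longrightarrow> v \<in> S l \<and> (\<forall>u\<in>S k. \<not> u \<unlhd> v)" by blast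
  \<comment> \<open>\<open>f k l\<close> is never below \<open>f l j\<close>; a coordinate witnessing this, chosen
    uniformly by Ramsey, gives an infinite descent.\<close>
  then obtain f where f: "\<And>k l. k < l \<Longrightarrow> f k l \<in> S l"
    and bad: "\<And>k l u. k < l \<Longrightarrow> u \<in> S k \<Longrightarrow> \<not> u \<unlhd> f k l" by metis
  \<comment> \<open>The first \<open>m\<close> coordinates of \<open>h\<close> hold positive parts
    and the next \<open>m\<close> negative parts; the conformal order becomes the componentwise
    order on \<open>2 * m\<close> naturals.\<close>
  define h where "h c u = (if c < m then nat (u $ c) else nat (- (u $ (c - m))))"
    for c and u :: "int vec"
  \<comment> \<open>Here \<open>f k l\<close> belongs to \<open>S l\<close>, and
    \<open>f l j\<close> was chosen to have no member of \<open>S l\<close> below it.\<close>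
  have "\<exists>c<2 * m. h c (f l j) < h c (f k l)" if kl: "k < l" "l < j" for k l j
  proof (rule ccontr)
    assume "\<not> ?thesis"
    then have le: "h c (f k l) \<le> h c (f l j)" if "c < 2 * m" for c using that by force
    have d: "f k l \<in> carrier_vec m" "f l j \<in> carrier_vec m" using f kl S by blast+
    have "f k l \<unlhd> f l j"
      unfolding conformal_def
    proof (intro conjI allI impI)
      show "dim_vec (f k l) = dim_vec (f l j)" using d by simp
      fix i assume "i < dim_vec (f l j)"
      then have i: "i < m" using d by simp
      have "nat (f k l $ i) \<le> nat (f l j $ i)" "nat (- (f k l $ i)) \<le> nat (- (f l j $ i))"
        using le[of i] le[of "i + m"] i by (simp_all add: h_def)
      then show "0 \<le> f k l $ i \<and> f k l $ i \<le> f l j $ i \<or> f l j $ i \<le> f k l $ i \<and> f k l $ i \<le> 0"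
        by linarith
    qed
    then show False using bad[OF kl(2) f[OF kl(1)]] by blast
  qed
  then obtain col where col: "\<And>k l j. k < l \<Longrightarrow> l < j \<Longrightarrow>
      col k l j < 2 * m \<and> h (col k l j) (f l j) < h (col k l j) (f k l)" by metis
  \<comment> \<open>Ramsey's theorem colours unordered 3-element sets; sorting recovers the triple
    \<open>k < l < j\<close>.\<close>
  define F where "F X = (let xs = sorted_list_of_set X in col (xs ! 0) (xs ! 1) (xs ! 2))"
    for X :: "nat set"
  have "F X < 2 * m" if "finite X" "card X = 3" for X
  proof -
    let ?xs = "sorted_list_of_set X"
    have "sorted_wrt (<) ?xs" "length ?xs = 3" using that by auto
    then have "?xs ! 0 < ?xs ! 1" "?xs ! 1 < ?xs ! 2" by (auto intro: sorted_wrt_nth_less)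
    then show ?thesis using col by (simp add: F_def Let_def)
  qed
  then obtain Y t where Y: "infinite Y" "\<And>X. X \<subseteq> Y \<Longrightarrow> finite X \<Longrightarrow> card X = 3 \<Longrightarrow> F X = t"
    using Ramsey[of UNIV 3 F "2 * m"] by auto
  define e where "e = enumerate Y"
  have e: "e n < e (Suc n)" "e n \<in> Y" for n
    using Y(1) by (auto simp: e_def enumerate_step enumerate_in_set)
  \<comment> \<open>Consecutive triples of the homogeneous set overlap in two indices, so their
    drops in the common coordinate \<open>t\<close> chain into an infinite descent.\<close>
  define a where "a n = h t (f (e n) (e (Suc n)))" for n
  have desc: "a (Suc n) < a n" for n
  proof -
    have lt: "e n < e (Suc n)" "e (Suc n) < e (Suc (Suc n))" using e by blast+
    then have "F {e n, e (Suc n), e (Suc (Suc n))} = col (e n) (e (Suc n)) (e (Suc (Suc n)))"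
      by (simp add: F_def sorted_list_of_set_insert_remove)
    moreover have "F {e n, e (Suc n), e (Suc (Suc n))} = t"
    proof (rule Y(2))
      have "e n \<noteq> e (Suc n)" "e n \<noteq> e (Suc (Suc n))" "e (Suc n) \<noteq> e (Suc (Suc n))"
        using lt by linarith+
      then show "card {e n, e (Suc n), e (Suc (Suc n))} = 3" by simp
    qed (use e(2) in auto)
    ultimately show ?thesis using col[OF lt] by (simp add: a_def)
  qed
  have "a n + n \<le> a 0" for n
  proof (induction n)
    case (Suc n)
    then show ?case using desc[of n] by linarith
  qed simp
  from this[of "Suc (a 0)"] show False by simp
qed

text \<open>Dickson's lemma for the conformal order, obtained as the case of singletons.\<close>

lemma finite_antichain:
  assumes Y: "Y \<subseteq> carrier_vec m" and anti: "\<And>u v. u \<in> Y \<Longrightarrow> v \<in> Y \<Longrightarrow> u \<unlhd> v \<Longrightarrow> u = v"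
  shows "finite Y"
proof (rule ccontr)
  assume "infinite Y"
  then obtain x :: "nat \<Rightarrow> int vec" where x: "inj x" "range x \<subseteq> Y"
    using infinite_countable_subset by blast
  have "{x k} \<subseteq> carrier_vec m" for k using x(2) Y by blast
  from sequence_of_sets_dominated[of "\<lambda>k. {x k}", OF this]
  obtain k l where "k < l" "x k \<unlhd> x l" by blast
  then show False using anti[of "x k" "x l"] x by (auto simp: inj_eq)
qed

section \<open>Vectors with a shared head and \<open>N\<close> blocks\<close>

text \<open>For \<open>v = (x, y_0, ..., y_(N-1))\<close> this is \<open>(x, y_i)\<close>. The index
  \<open>i * nA + j\<close> is \<open>nB + i * nA + (j - nB)\<close> simplified.\<close>

definition head_block :: "nat \<Rightarrow> nat \<Rightarrow> nat \<Rightarrow> int vec \<Rightarrow> int vec" where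
  "head_block nB nA i v = vec (nB + nA) (\<lambda>j. if j < nB then v $ j else v $ (i * nA + j))"

text \<open>With \<open>K\<close> the kernel of \<open>(B A)\<close>, this is the kernel of the
  lower block rows of the \<open>N\<close>-fold matrix.\<close>

definition two_stage :: "nat \<Rightarrow> nat \<Rightarrow> nat \<Rightarrow> int vec set \<Rightarrow> int vec set" where
  "two_stage nB nA N K =
     {v \<in> carrier_vec (nB + N * nA). \<forall>i<N. head_block nB nA i v \<in> K}"

text \<open>Reassembles a long vector from its blocks. Every \<open>u i\<close> carries its own copy
  of the head, which is expected to agree with \<open>x\<close>.\<close>

definition glue :: "nat \<Rightarrow> nat \<Rightarrow> nat \<Rightarrow> int vec \<Rightarrow> (nat \<Rightarrow> int vec) \<Rightarrow> int vec" where
  "glue nB nA N x u = vec (nB + N * nA)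
     (\<lambda>j. if j < nB then x $ j else u ((j - nB) div nA) $ (nB + (j - nB) mod nA))"

lemma block_index_less:
  fixes i N a nA :: nat
  assumes "i < N" "a < nA"
  shows "i * nA + a < N * nA"
proof -
  have "i * nA + a < Suc i * nA" using assms by simp
  also have "\<dots> \<le> N * nA" using assms by (intro mult_le_mono1) simp
  finally show ?thesis .
qed

lemma head_block_carrier [simp]: "head_block nB nA i v \<in> carrier_vec (nB + nA)"
  by (simp add: head_block_def)

lemma glue_carrier: "glue nB nA N x u \<in> carrier_vec (nB + N * nA)"
  by (simp add: glue_def)

lemma head_block_glue:
  assumes i: "i < N" and u: "u i \<in> carrier_vec (nB + nA)" "vec_first (u i) nB = x"
  shows "head_block nB nA i (glue nB nA N x u) = u i"
proof (rule eq_vecI)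
  show "dim_vec (head_block nB nA i (glue nB nA N x u)) = dim_vec (u i)"
    using u(1) by (simp add: head_block_def)
  fix j assume "j < dim_vec (u i)"
  then have j: "j < nB + nA" using u(1) by simp
  show "head_block nB nA i (glue nB nA N x u) $ j = u i $ j"
  proof (cases "j < nB")
    case True
    have "x $ j = u i $ j" unfolding u(2)[symmetric] vec_first_def using True by simp
    then show ?thesis using True by (simp add: head_block_def glue_def)
  next
    case False
    define a where "a = j - nB"
    have ja: "j = nB + a" and a: "a < nA" using False j by (auto simp: a_def)
    have "i * nA + j = nB + (i * nA + a)" using ja by simp
    moreover have "(i * nA + a) div nA = i" "(i * nA + a) mod nA = a" using a by simp_all
    ultimately show ?thesis
      using block_index_less[OF i a] j ja by (simp add: head_block_def glue_def)
  qed
qed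

lemma glue_index:
  assumes "j < N * nA"
  shows "glue nB nA N x u $ (nB + j) = u (j div nA) $ (nB + j mod nA)"
  using assms by (simp add: glue_def)

lemma index_head_block:
  assumes "j < N * nA"
  shows "v $ (nB + j) = head_block nB nA (j div nA) v $ (nB + j mod nA)"
    and "j div nA < N" and "j mod nA < nA"
proof -
  have nA: "0 < nA" using assms by (cases nA) auto
  then show "j mod nA < nA" by simp
  moreover have "j div nA * nA + (nB + j mod nA) = nB + j"
    by (simp add: add.left_commute)
  ultimately show "v $ (nB + j) = head_block nB nA (j div nA) v $ (nB + j mod nA)"
    by (simp add: head_block_def add.commute)
  show "j div nA < N" using assms by (simp add: less_mult_imp_div_less)
qed

lemma glue_conformal:
  assumes v: "v \<in> carrier_vec (nB + N * nA)" and N: "0 < N"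
    and u: "\<And>i. i < N \<Longrightarrow> u i \<unlhd> head_block nB nA i v" "\<And>i. i < N \<Longrightarrow> vec_first (u i) nB = x"
  shows "glue nB nA N x u \<unlhd> v"
proof (rule conformalI)
  show "dim_vec (glue nB nA N x u) = dim_vec v" using v by (simp add: glue_def)
  fix j assume "j < dim_vec v"
  then have j: "j < nB + N * nA" using v by simp
  let ?g = "glue nB nA N x u"
  \<comment> \<open>Every coordinate is visible in some block. Head coordinates are read off block
    \<open>0\<close>, which exists because \<open>0 < N\<close>.\<close>
  have "\<exists>i<N. \<exists>k<nB + nA. ?g $ j = u i $ k \<and> v $ j = head_block nB nA i v $ k"
  proof (cases "j < nB")
    case True
    have "x $ j = u 0 $ j" unfolding u(2)[OF N, symmetric] vec_first_def using True by simp
    then show ?thesis using True N by (intro exI[of _ 0] conjI exI[of _ j])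
      (auto simp: glue_def head_block_def)
  next
    case False
    define a where "a = j - nB"
    have ja: "j = nB + a" and a: "a < N * nA" using False j by (auto simp: a_def)
    show ?thesis
      using index_head_block(1)[OF a, of v nB] index_head_block(2,3)[OF a] glue_index[OF a, of nB x u] ja
      by (intro exI[of _ "a div nA"] conjI exI[of _ "nB + a mod nA"]) auto
  qed
  then obtain i k where "i < N" "k < nB + nA" "?g $ j = u i $ k" "v $ j = head_block nB nA i v $ k"
    by blast
  then show "0 \<le> ?g $ j \<and> ?g $ j \<le> v $ j \<or> v $ j \<le> ?g $ j \<and> ?g $ j \<le> 0"
    using conformalD[OF u(1)[of i], of k] by (simp add: head_block_def)
qed

lemma glue_two_stage:
  assumes "\<And>i. i < N \<Longrightarrow> u i \<in> K" "K \<subseteq> carrier_vec (nB + nA)"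
    and "\<And>i. i < N \<Longrightarrow> vec_first (u i) nB = x"
  shows "glue nB nA N x u \<in> two_stage nB nA N K"
  using assms head_block_glue[of _ N u nB nA x] glue_carrier[of nB nA N x u]
  unfolding two_stage_def by (simp add: subset_iff)

lemma vec_first_head_block: "vec_first (head_block nB nA i v) nB = vec_first v nB"
  by (rule eq_vecI) (simp_all add: vec_first_def head_block_def)

lemma vec_first_zero: "vec_first (0\<^sub>v (n + m)) n = 0\<^sub>v n"
  by (rule eq_vecI) (simp_all add: vec_first_def)

lemma head_block_zero:
  assumes "i < N"
  shows "head_block nB nA i (0\<^sub>v (nB + N * nA)) = 0\<^sub>v (nB + nA)"
proof (rule eq_vecI)
  fix j assume "j < dim_vec (0\<^sub>v (nB + nA) :: int vec)"
  then have j: "j < nB + nA" by simp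
  show "head_block nB nA i (0\<^sub>v (nB + N * nA)) $ j = 0\<^sub>v (nB + nA) $ j"
  proof (cases "j < nB")
    case False
    then have "i * nA + (j - nB) < N * nA" using assms j by (intro block_index_less) auto
    then have "i * nA + j < nB + N * nA" using False by simp
    then show ?thesis using j by (simp add: head_block_def)
  qed (use j in \<open>simp add: head_block_def\<close>)
qed (simp add: head_block_def)

text \<open>The fibres of \<open>K\<close> over infinitely many heads would include one over
  \<open>x k\<close> that dominates the fibre over another head \<open>x l\<close>. In an
  irreducible vector with head \<open>x l\<close>, each block could then be replaced by a
  conformally smaller one with head \<open>x k\<close>, contradicting minimality. The fibres do not
  depend on \<open>N\<close>, so all \<open>N\<close> are treated together.\<close>

lemma finite_heads_two_stage:
  assumes K: "K \<subseteq> carrier_vec (nB + nA)"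
  shows "finite (\<Union>N\<in>{0<..}. (\<lambda>v. vec_first v nB) `
    irreducibles (nB + N * nA) (two_stage nB nA N K))" (is "finite ?X")
proof (rule ccontr)
  assume "infinite ?X"
  \<comment> \<open>Dropping the zero head guarantees that the vector glued below is
    nonzero.\<close>
  then have "infinite (?X - {0\<^sub>v nB})" by simp
  then obtain x :: "nat \<Rightarrow> int vec" where x: "inj x" "range x \<subseteq> ?X - {0\<^sub>v nB}"
    using infinite_countable_subset by blast
  define S where "S k = {u \<in> K. vec_first u nB = x k}" for k
  have "S k \<subseteq> carrier_vec (nB + nA)" for k using K by (auto simp: S_def)
  from sequence_of_sets_dominated[of S, OF this]
  obtain k l where kl: "k < l" and dom: "\<And>v. v \<in> S l \<Longrightarrow> \<exists>u\<in>S k. u \<unlhd> v" by blast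
  have "x l \<in> ?X" using x(2) by blast
  then obtain N v where N: "0 < N" and v: "v \<in> irreducibles (nB + N * nA) (two_stage nB nA N K)"
    and xl: "x l = vec_first v nB" by blast
  have vL: "v \<in> two_stage nB nA N K" and vn: "v \<in> carrier_vec (nB + N * nA)"
    and vmin: "\<And>w. w \<in> two_stage nB nA N K \<Longrightarrow> w \<noteq> 0\<^sub>v (nB + N * nA) \<Longrightarrow> w \<unlhd> v \<Longrightarrow> w = v"
    using v unfolding irreducibles_def two_stage_def by blast+
  have "\<exists>u\<in>S k. u \<unlhd> head_block nB nA i v" if "i < N" for i
    using dom[of "head_block nB nA i v"] vL that xl
    unfolding S_def two_stage_def by (simp add: vec_first_head_block)
  then obtain u where u: "\<And>i. i < N \<Longrightarrow> u i \<in> S k" "\<And>i. i < N \<Longrightarrow> u i \<unlhd> head_block nB nA i v"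
    by metis
  have uK: "\<And>i. i < N \<Longrightarrow> u i \<in> K" "\<And>i. i < N \<Longrightarrow> vec_first (u i) nB = x k"
    using u(1) unfolding S_def by blast+
  define w where "w = glue nB nA N (x k) u"
  have w: "w \<in> two_stage nB nA N K" "w \<unlhd> v"
    unfolding w_def by (rule glue_two_stage glue_conformal; use vn N u uK K in blast)+
  have "head_block nB nA 0 w = u 0"
    unfolding w_def using uK[OF N] K by (intro head_block_glue N) blast+
  then have wx: "vec_first w nB = x k"
    using vec_first_head_block[of nB nA 0 w] uK(2)[OF N] by simp
  have "w \<noteq> 0\<^sub>v (nB + N * nA)"
  proof
    assume "w = 0\<^sub>v (nB + N * nA)"
    then have "x k = 0\<^sub>v nB" using wx vec_first_zero by metis
    then show False using x(2) by blast
  qed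
  then have "w = v" using vmin w by blast
  then have "x k = x l" using wx xl by simp
  then show False using x(1) kl by (simp add: inj_eq)
qed

text \<open>Replacing block \<open>i\<close> alone by \<open>u\<close> and keeping the others yields
  a nonzero element below \<open>v\<close>, hence \<open>v\<close> itself. So each nonzero block is
  minimal among the nonzero elements of \<open>K\<close> with the same head.\<close>

lemma head_block_minimal:
  assumes K: "K \<subseteq> carrier_vec (nB + nA)"
    and v: "v \<in> irreducibles (nB + N * nA) (two_stage nB nA N K)" and i: "i < N"
    and u: "u \<in> K" "u \<noteq> 0\<^sub>v (nB + nA)" "vec_first u nB = vec_first v nB" "u \<unlhd> head_block nB nA i v"
  shows "u = head_block nB nA i v"
proof -
  have vL: "v \<in> two_stage nB nA N K" and vn: "v \<in> carrier_vec (nB + N * nA)"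
    and vmin: "\<And>w. w \<in> two_stage nB nA N K \<Longrightarrow> w \<noteq> 0\<^sub>v (nB + N * nA) \<Longrightarrow> w \<unlhd> v \<Longrightarrow> w = v"
    using v unfolding irreducibles_def two_stage_def by blast+
  define f where "f j = (if j = i then u else head_block nB nA j v)" for j
  have f: "\<And>j. j < N \<Longrightarrow> f j \<in> K" "\<And>j. j < N \<Longrightarrow> f j \<unlhd> head_block nB nA j v"
    "\<And>j. j < N \<Longrightarrow> vec_first (f j) nB = vec_first v nB"
    using u vL conformal_refl by (simp_all add: f_def two_stage_def vec_first_head_block)
  define w where "w = glue nB nA N (vec_first v nB) f"
  have w: "w \<in> two_stage nB nA N K" "w \<unlhd> v"
    unfolding w_def by (rule glue_two_stage glue_conformal; use vn i f K in force)+
  have wi: "head_block nB nA i w = u"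
    using head_block_glue[of i N f nB nA "vec_first v nB", OF i] f(1,3)[OF i] K
    by (auto simp: w_def f_def)
  then have "w \<noteq> 0\<^sub>v (nB + N * nA)" using u(2) head_block_zero[OF i] by metis
  then have "w = v" using vmin w by blast
  then show ?thesis using wi by simp
qed

text \<open>Only finitely many heads occur, and the minimal nonzero elements of \<open>K\<close>
  over each head form an antichain. Hence all blocks, for all \<open>N\<close> together, come from
  one finite set.\<close>

lemma two_stage_irreducible_entries_bounded:
  assumes K: "K \<subseteq> carrier_vec (nB + nA)"
  shows "\<exists>c\<ge>0. \<forall>N>0. \<forall>v\<in>irreducibles (nB + N * nA) (two_stage nB nA N K).
    \<forall>j<nB + N * nA. \<bar>v $ j\<bar> \<le> c"
proof -
  define X where "X = (\<Union>N\<in>{0<..}. (\<lambda>v. vec_first v nB) `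
    irreducibles (nB + N * nA) (two_stage nB nA N K))"
  \<comment> \<open>Zero is excluded because over the zero head it could lie below every other
    element of the fibre.\<close>
  define Min where "Min x = {u \<in> K. vec_first u nB = x \<and> u \<noteq> 0\<^sub>v (nB + nA) \<and>
    (\<forall>u'\<in>K. u' \<noteq> 0\<^sub>v (nB + nA) \<longrightarrow> vec_first u' nB = x \<longrightarrow> u' \<unlhd> u \<longrightarrow> u' = u)}" for x
  have "finite (Min x)" for x
    by (rule finite_antichain[of _ "nB + nA"]) (use K in \<open>unfold Min_def, blast+\<close>)
  then have "finite (\<Union>x\<in>X. Min x)" using finite_heads_two_stage[OF K] unfolding X_def by (rule finite_UN_I[rotated])
  \<comment> \<open>The inserted \<open>0\<close> accounts for zero blocks and makes
    \<open>c\<close> nonnegative.\<close>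
  then have fin: "finite (insert 0 (\<Union>u\<in>(\<Union>x\<in>X. Min x). (\<lambda>k. \<bar>u $ k\<bar>) ` {..<nB + nA}))"
    (is "finite ?E") by blast
  define c where "c = Max ?E"
  have c: "e \<le> c" if "e \<in> ?E" for e unfolding c_def by (rule Max_ge[OF fin that])
  have block: "\<bar>head_block nB nA i v $ k\<bar> \<le> c"
    if N: "0 < N" and v: "v \<in> irreducibles (nB + N * nA) (two_stage nB nA N K)"
      and i: "i < N" and k: "k < nB + nA" for N v i k
  proof (cases "head_block nB nA i v = 0\<^sub>v (nB + nA)")
    case True
    then show ?thesis using k c[of 0] by simp
  next
    case False
    have "head_block nB nA i v \<in> K" using v i unfolding irreducibles_def two_stage_def by blast
    then have "head_block nB nA i v \<in> Min (vec_first v nB)"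
      using False head_block_minimal[OF K v i] unfolding Min_def
      by (simp add: vec_first_head_block)
    moreover have "vec_first v nB \<in> X" using v N unfolding X_def by blast
    ultimately show ?thesis using k by (intro c) blast
  qed
  have "\<bar>v $ j\<bar> \<le> c" if N: "0 < N" and v: "v \<in> irreducibles (nB + N * nA) (two_stage nB nA N K)"
    and j: "j < nB + N * nA" for N v j
  proof (cases "j < nB")
    case True
    then show ?thesis using block[OF N v N, of j] by (simp add: head_block_def)
  next
    case False
    define a where "a = j - nB"
    have ja: "j = nB + a" and a: "a < N * nA" using False j by (auto simp: a_def)
    show ?thesis using block[OF N v index_head_block(2)[OF a], of "nB + a mod nA"]
      index_head_block(1)[OF a, of v nB] index_head_block(3)[OF a] ja by simp
  qed
  moreover have "0 \<le> c" using c by blast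
  ultimately show ?thesis by blast
qed

section \<open>Inserting several rows\<close>

lemma funpow_bound_nonneg:
  fixes M K :: int
  assumes "0 \<le> M" "0 \<le> K"
  shows "0 \<le> ((\<lambda>k. k * (2 * M * k + 1)) ^^ m) K"
  by (induction m) (use assms in auto)

text \<open>The one-row bound is iterated: the bound reached so far serves as \<open>K\<close> for
  the next row, with one \<open>M\<close> common to all rows.\<close>

lemma irreducible_norm_insert_rows:
  fixes M K :: int
  assumes R: "R \<subseteq> carrier_vec n" and "set rs \<subseteq> carrier_vec n"
    and "\<And>r i. r \<in> set rs \<Longrightarrow> i < n \<Longrightarrow> \<bar>r $ i\<bar> \<le> M" and M: "0 \<le> M" and K: "0 \<le> K"
    and bound: "\<And>g. g \<in> irreducibles n (orth n R) \<Longrightarrow> l1_norm g \<le> K"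
    and "v \<in> irreducibles n (orth n (set rs \<union> R))"
  shows "l1_norm v \<le> ((\<lambda>k. k * (2 * M * k + 1)) ^^ length rs) K"
  using assms(2,3,7)
proof (induction rs arbitrary: v)
  case Nil
  then show ?case using bound by simp
next
  case (Cons r rs)
  let ?f = "\<lambda>k. k * (2 * M * k + 1)"
  have c: "set rs \<union> R \<subseteq> carrier_vec n" "r \<in> carrier_vec n" "set rs \<subseteq> carrier_vec n"
    using R Cons.prems(1) by simp_all
  have rM: "\<bar>r $ i\<bar> \<le> M" if "i < n" for i using Cons.prems(2) that by simp
  have IH: "l1_norm g \<le> (?f ^^ length rs) K" if "g \<in> irreducibles n (orth n (set rs \<union> R))" for g
    by (rule Cons.IH[OF c(3) _ that]) (use Cons.prems(2) in simp)
  have "v \<in> irreducibles n (orth n (insert r (set rs \<union> R)))" using Cons.prems(3) by simp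
  from irreducible_norm_insert_row[OF c(1,2) rM M funpow_bound_nonneg[OF M K] IH this]
  show ?case by simp
qed

section \<open>Rows of the \<open>N\<close>-fold matrix\<close>

lemma diag_block_replicate_index:
  fixes A :: "int mat"
  assumes "A \<in> carrier_mat dA nA" "r < N * dA" "j < N * nA"
  shows "diag_block_mat (replicate N A) $$ (r, j) =
    (if r div dA = j div nA then A $$ (r mod dA, j mod nA) else 0)"
  using assms(2,3)
proof (induction N arbitrary: r j)
  case 0
  then show ?case by simp
next
  case (Suc N)
  have dims: "dim_row A = dA" "dim_col A = nA" using assms(1) by auto
  have pos: "0 < dA" "0 < nA" using Suc.prems by (auto intro: gr0I)
  have D: "dim_row (diag_block_mat (replicate N A)) = N * dA"
    "dim_col (diag_block_mat (replicate N A)) = N * nA"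
    by (simp_all add: dim_diag_block_mat sum_list_replicate dims)
  \<comment> \<open>Passing the leading block raises the block number by one and keeps the
    offset.\<close>
  have shift: "a div d = Suc ((a - d) div d)" "a mod d = (a - d) mod d"
    if "\<not> a < d" "0 < d" for a d :: nat
    using that by (simp_all add: le_div_geq le_mod_geq)
  have "diag_block_mat (replicate (Suc N) A) $$ (r, j) =
    (if r < dA then if j < nA then A $$ (r, j) else 0
     else if j < nA then 0 else diag_block_mat (replicate N A) $$ (r - dA, j - nA))"
    using Suc.prems by (simp add: Let_def D dims)
  also have "\<dots> = (if r div dA = j div nA then A $$ (r mod dA, j mod nA) else 0)"
  proof (cases "r < dA \<or> j < nA")
    case True
    then show ?thesis using pos shift[of r dA] shift[of j nA] by (cases "r < dA"; cases "j < nA") auto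
  next
    case False
    then have "r - dA < N * dA" "j - nA < N * nA" using Suc.prems by auto
    then show ?thesis using False pos shift[of r dA] shift[of j nA] Suc.IH by simp
  qed
  finally show ?case .
qed

lemma nfold_upper_row_index:
  fixes C D :: "int mat"
  assumes "A \<in> carrier_mat dA nA" "C \<in> carrier_mat dC nB" "D \<in> carrier_mat dC nA"
    and "i < dC" "j < nB + N * nA"
  shows "nfold_four_block C D B A N $$ (i, j) =
    (if j < nB then C $$ (i, j) else D $$ (i, (j - nB) mod nA))"
proof -
  have "dim_row (diag_block_mat (replicate N A)) = N * dA"
    "dim_col (diag_block_mat (replicate N A)) = N * nA"
    using assms(1) by (simp_all add: dim_diag_block_mat sum_list_replicate)
  then show ?thesis using assms by (simp add: nfold_four_block_def repeat_cols_def)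
qed

lemma nfold_lower_row_index:
  fixes A B C :: "int mat"
  assumes "A \<in> carrier_mat dA nA" "B \<in> carrier_mat dA nB" "C \<in> carrier_mat dC nB"
    and "i < N" "t < dA" "j < nB + N * nA"
  shows "nfold_four_block C D B A N $$ (dC + (i * dA + t), j) =
    (if j < nB then B $$ (t, j)
     else if (j - nB) div nA = i then A $$ (t, (j - nB) mod nA) else 0)"
proof -
  have d: "dim_row (diag_block_mat (replicate N A)) = N * dA"
    "dim_col (diag_block_mat (replicate N A)) = N * nA"
    using assms(1) by (simp_all add: dim_diag_block_mat sum_list_replicate)
  have lt: "i * dA + t < N * dA" using assms by (intro block_index_less)
  have dm: "(i * dA + t) div dA = i" "(i * dA + t) mod dA = t" using assms by simp_all
  have "diag_block_mat (replicate N A) $$ (i * dA + t, k) =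
    (if i = k div nA then A $$ (t, k mod nA) else 0)" if "k < N * nA" for k
    using diag_block_replicate_index[OF assms(1) lt that] dm by simp
  then show ?thesis
    using assms d lt dm by (simp add: nfold_four_block_def repeat_rows_def)
qed

text \<open>Outside the head, a row of block row \<open>i\<close> is supported on the columns of
  block \<open>i\<close>. Its equation is therefore a row of \<open>(B A)\<close> applied to the
  head and that block.\<close>

lemma nfold_lower_row_scalar_prod:
  fixes A B C :: "int mat"
  assumes A: "A \<in> carrier_mat dA nA" and B: "B \<in> carrier_mat dA nB" and C: "C \<in> carrier_mat dC nB"
    and i: "i < N" and t: "t < dA" and v: "v \<in> carrier_vec (nB + N * nA)"
  shows "row (nfold_four_block C D B A N) (dC + (i * dA + t)) \<bullet> v =
    (row B t @\<^sub>v row A t) \<bullet> head_block nB nA i v"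
proof -
  let ?E = "nfold_four_block C D B A N"
  have E: "?E \<in> carrier_mat (dC + N * dA) (nB + N * nA)" by (rule nfold_four_block_carrier[OF A C])
  have lt: "dC + (i * dA + t) < dC + N * dA" using i t block_index_less by simp
  have split: "(\<Sum>j<a + b. f j) = (\<Sum>j<a. f j) + (\<Sum>j<b. f (a + j))" for a b and f :: "nat \<Rightarrow> int"
    by (induction b) (simp_all add: add.assoc)
  have "row ?E (dC + (i * dA + t)) \<bullet> v =
    (\<Sum>j<nB + N * nA. ?E $$ (dC + (i * dA + t), j) * v $ j)"
    using E lt v unfolding scalar_prod_def atLeast0LessThan by (intro sum.cong) auto
  also have "\<dots> = (\<Sum>j<nB. B $$ (t, j) * v $ j) +
      (\<Sum>j<N * nA. if j div nA = i then A $$ (t, j mod nA) * v $ (nB + j) else 0)"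
    unfolding split using nfold_lower_row_index[OF A B C i t]
    by (intro arg_cong2[of _ _ _ _ "(+)"] sum.cong) auto
  also have "(\<Sum>j<N * nA. if j div nA = i then A $$ (t, j mod nA) * v $ (nB + j) else 0) =
      (\<Sum>j\<in>{j. j < N * nA \<and> j div nA = i}. A $$ (t, j mod nA) * v $ (nB + j))"
    by (simp add: sum.If_cases Int_def)
  also have "\<dots> = (\<Sum>a<nA. A $$ (t, a) * v $ (nB + (i * nA + a)))"
  proof (rule sum.reindex_bij_witness[of _ "\<lambda>a. i * nA + a" "\<lambda>j. j mod nA"])
    fix j assume "j \<in> {j. j < N * nA \<and> j div nA = i}"
    then have j: "j < N * nA" "j div nA = i" by auto
    then have "0 < nA" by (cases nA) auto
    then show "i * nA + j mod nA = j" "j mod nA \<in> {..<nA}" using j(2) by auto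
    then show "A $$ (t, j mod nA) * v $ (nB + (i * nA + j mod nA)) = A $$ (t, j mod nA) * v $ (nB + j)"
      by simp
  next
    fix a assume "a \<in> {..<nA}"
    then show "(i * nA + a) mod nA = a" "i * nA + a \<in> {j. j < N * nA \<and> j div nA = i}"
      using block_index_less[OF i] by auto
  qed
  also have "(\<Sum>j<nB. B $$ (t, j) * v $ j) + \<dots> =
      (\<Sum>j<nB + nA. (row B t @\<^sub>v row A t) $ j * head_block nB nA i v $ j)"
    unfolding split using A B t
    by (intro arg_cong2[of _ _ _ _ "(+)"] sum.cong) (auto simp: head_block_def ac_simps)
  also have "\<dots> = (row B t @\<^sub>v row A t) \<bullet> head_block nB nA i v"
    unfolding scalar_prod_def atLeast0LessThan by (simp add: head_block_def)
  finally show ?thesis .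
qed

text \<open>The rows of the matrix are split into the \<open>dC\<close> upper rows and the lower
  rows \<open>R\<close>, whose kernel is the two-stage set. This prepares the insertion of the upper
  rows into an already bounded situation.\<close>

lemma graver_basis_nfold_subset:
  fixes A B C D :: "int mat"
  assumes A: "A \<in> carrier_mat dA nA" and B: "B \<in> carrier_mat dA nB" and C: "C \<in> carrier_mat dC nB"
  defines "n \<equiv> \<lambda>N. nB + N * nA"
  defines "E \<equiv> nfold_four_block C D B A"
  defines "K \<equiv> orth (nB + nA) ((\<lambda>t. row B t @\<^sub>v row A t) ` {..<dA})"
  shows "\<exists>R\<subseteq>carrier_vec (n N). orth (n N) R = two_stage nB nA N K \<and>
    graver_basis (E N) \<subseteq> irreducibles (n N) (orth (n N) (set (map (row (E N)) [0..<dC]) \<union> R))"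
proof -
  have EN: "E N \<in> carrier_mat (dC + N * dA) (n N)"
    unfolding E_def n_def by (rule nfold_four_block_carrier[OF A C])
  define R where "R = (\<lambda>k. row (E N) (dC + k)) ` {..<N * dA}"
  have "x \<in> (+) dC ` {..<m} \<longleftrightarrow> dC \<le> x \<and> x < dC + m" for x m
    by (auto intro!: image_eqI[of _ _ "x - dC"])
  then have "{0..<dC + m} = {0..<dC} \<union> (+) dC ` {..<m}" for m by auto
  then have "set (rows (E N)) = row (E N) ` ({0..<dC} \<union> (+) dC ` {..<N * dA})"
    using carrier_matD(1)[OF EN] by (simp add: rows_def)
  also have "\<dots> = set (map (row (E N)) [0..<dC]) \<union> R"
    unfolding R_def by (simp add: image_Un image_image)
  finally have "graver_basis (E N) \<subseteq> irreducibles (n N) (orth (n N) (set (map (row (E N)) [0..<dC]) \<union> R))"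
    using graver_basis_subset_irreducibles[of "E N"] unfolding carrier_matD(2)[OF EN] by metis
  moreover have "R \<subseteq> carrier_vec (n N)" unfolding R_def using row_carrier[of "E N"] unfolding carrier_matD(2)[OF EN] by blast
  moreover have "orth (n N) R = two_stage nB nA N K"
  proof -
    have "(\<forall>r\<in>R. r \<bullet> v = 0) \<longleftrightarrow> (\<forall>i<N. head_block nB nA i v \<in> K)" if v: "v \<in> carrier_vec (n N)" for v
    proof -
      have block: "head_block nB nA i v \<in> K \<longleftrightarrow> (\<forall>t<dA. row (E N) (dC + (i * dA + t)) \<bullet> v = 0)"
        if "i < N" for i
        using nfold_lower_row_scalar_prod[OF A B C that _ v[unfolded n_def], of _ D]
        by (auto simp: K_def orth_def E_def)
      have "(\<forall>r\<in>R. r \<bullet> v = 0) \<longleftrightarrow> (\<forall>k<N * dA. row (E N) (dC + k) \<bullet> v = 0)"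
        unfolding R_def by auto
      also have "\<dots> \<longleftrightarrow> (\<forall>i<N. \<forall>t<dA. row (E N) (dC + (i * dA + t)) \<bullet> v = 0)"
      proof (intro iffI allI impI)
        fix k assume *: "\<forall>i<N. \<forall>t<dA. row (E N) (dC + (i * dA + t)) \<bullet> v = 0" and k: "k < N * dA"
        have "0 < dA" using k by (cases dA) auto
        then have "k div dA < N" "k mod dA < dA" using k by (simp_all add: less_mult_imp_div_less)
        then have "row (E N) (dC + (k div dA * dA + k mod dA)) \<bullet> v = 0" using * by blast
        then show "row (E N) (dC + k) \<bullet> v = 0" unfolding div_mult_mod_eq .
      qed (use block_index_less in blast)
      also have "\<dots> \<longleftrightarrow> (\<forall>i<N. head_block nB nA i v \<in> K)"
        using block by blast
      finally show ?thesis .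
    qed
    then show ?thesis unfolding orth_def two_stage_def n_def by blast
  qed
  ultimately show ?thesis by blast
qed

section \<open>Polynomial bound in \<open>N\<close>\<close>

lemma ex_double_bound:
  fixes f :: "nat \<Rightarrow> nat \<Rightarrow> int"
  shows "\<exists>M\<ge>0. \<forall>i<a. \<forall>j<b. \<bar>f i j\<bar> \<le> M"
proof (intro exI[of _ "\<Sum>p\<in>{..<a} \<times> {..<b}. \<bar>f (fst p) (snd p)\<bar>"] conjI allI impI)
  fix i j assume "i < a" "j < b"
  then show "\<bar>f i j\<bar> \<le> (\<Sum>p\<in>{..<a} \<times> {..<b}. \<bar>f (fst p) (snd p)\<bar>)"
    using member_le_sum[of "(i, j)" "{..<a} \<times> {..<b}" "\<lambda>p. \<bar>f (fst p) (snd p)\<bar>"] by simp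
qed (simp add: sum_nonneg)

text \<open>Each iteration sends \<open>p\<close> to \<open>p * (2 * M * p + 1)\<close>, again a
  polynomial. Starting from a linear one, the degree is at most \<open>2 ^ m\<close>, independently
  of \<open>N\<close>.\<close>

lemma funpow_bound_poly:
  fixes M a b :: int
  shows "\<exists>p :: real poly. \<forall>N :: nat.
    real_of_int (((\<lambda>k. k * (2 * M * k + 1)) ^^ m) (a + b * int N)) = poly p (real N)"
proof (induction m)
  case 0
  show ?case by (rule exI[of _ "[:of_int a, of_int b:]"]) (simp add: mult.commute)
next
  case (Suc m)
  then obtain p :: "real poly" where p: "\<And>N :: nat.
    real_of_int (((\<lambda>k. k * (2 * M * k + 1)) ^^ m) (a + b * int N)) = poly p (real N)" by blast
  show ?case
    by (rule exI[of _ "p * ([:2 * of_int M:] * p + 1)"]) (simp add: p)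
qed

text \<open>Nonnegativity of \<open>b\<close> serves the empty basis, whose maximum is
  \<open>0\<close> by convention.\<close>

lemma max_graver_norm_le:
  assumes "\<And>v. v \<in> graver_basis E \<Longrightarrow> l1_norm v \<le> b" "0 \<le> b"
  shows "max_graver_norm E \<le> b"
  using assms finite_graver_basis[of E] by (auto simp: max_graver_norm_def)

text \<open>Entries bounded by \<open>c\<close> give the lower rows the norm bound
  \<open>c * (nB + N * nA)\<close>, linear in \<open>N\<close>. The \<open>dC\<close> upper rows are
  then inserted, so the number of iterations does not depend on \<open>N\<close>.\<close>

lemma max_graver_norm_nfold_le:
  fixes A B C D :: "int mat"
  assumes A: "A \<in> carrier_mat dA nA" and B: "B \<in> carrier_mat dA nB"
    and C: "C \<in> carrier_mat dC nB" and D: "D \<in> carrier_mat dC nA"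
  shows "\<exists>M\<ge>0. \<exists>c\<ge>0. \<forall>N>0. max_graver_norm (nfold_four_block C D B A N)
    \<le> ((\<lambda>k. k * (2 * M * k + 1)) ^^ dC) (c * int nB + c * int nA * int N)"
proof -
  obtain MC where MC: "0 \<le> MC" "\<And>i j. i < dC \<Longrightarrow> j < nB \<Longrightarrow> \<bar>C $$ (i, j)\<bar> \<le> MC"
    using ex_double_bound[of dC nB "\<lambda>i j. C $$ (i, j)"] by blast
  obtain MD where MD: "0 \<le> MD" "\<And>i j. i < dC \<Longrightarrow> j < nA \<Longrightarrow> \<bar>D $$ (i, j)\<bar> \<le> MD"
    using ex_double_bound[of dC nA "\<lambda>i j. D $$ (i, j)"] by blast
  \<comment> \<open>The upper rows only repeat entries of \<open>C\<close> and \<open>D\<close>, so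
    one bound works for every \<open>N\<close>.\<close>
  define M where "M = max MC MD"
  define K where "K = orth (nB + nA) ((\<lambda>t. row B t @\<^sub>v row A t) ` {..<dA})"
  have "K \<subseteq> carrier_vec (nB + nA)" by (auto simp: K_def orth_def)
  from two_stage_irreducible_entries_bounded[OF this]
  obtain c where c: "0 \<le> c" "\<And>N v j. 0 < N \<Longrightarrow>
    v \<in> irreducibles (nB + N * nA) (two_stage nB nA N K) \<Longrightarrow> j < nB + N * nA \<Longrightarrow> \<bar>v $ j\<bar> \<le> c"
    by blast
  have "max_graver_norm (nfold_four_block C D B A N)
    \<le> ((\<lambda>k. k * (2 * M * k + 1)) ^^ dC) (c * int nB + c * int nA * int N)" if N: "0 < N" for N
  proof (rule max_graver_norm_le)
    let ?n = "nB + N * nA" and ?E = "nfold_four_block C D B A N"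
    let ?b = "c * int nB + c * int nA * int N"
    let ?rs = "map (row ?E) [0..<dC]"
    have M0: "0 \<le> M" using MC(1) by (simp add: M_def)
    have b0: "0 \<le> ?b" using c(1) by simp
    show "0 \<le> ((\<lambda>k. k * (2 * M * k + 1)) ^^ dC) ?b" by (rule funpow_bound_nonneg[OF M0 b0])
    obtain R where R: "R \<subseteq> carrier_vec ?n" "orth ?n R = two_stage nB nA N K"
      "graver_basis ?E \<subseteq> irreducibles ?n (orth ?n (set ?rs \<union> R))"
      using graver_basis_nfold_subset[OF A B C, where D = D and N = N] unfolding K_def by blast
    have E: "?E \<in> carrier_mat (dC + N * dA) ?n" by (rule nfold_four_block_carrier[OF A C])
    have rs: "set ?rs \<subseteq> carrier_vec ?n"
      using row_carrier[of ?E] unfolding carrier_matD(2)[OF E] by auto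
    have "\<bar>row ?E i $ j\<bar> \<le> M" if i: "i < dC" and j: "j < ?n" for i j
    proof -
      have eq: "row ?E i $ j = (if j < nB then C $$ (i, j) else D $$ (i, (j - nB) mod nA))"
        using nfold_upper_row_index[OF A C D i j] E i j by simp
      \<comment> \<open>A column beyond the head exists only if \<open>nA\<close> is positive, so
        the remainder is a genuine column index of \<open>D\<close>.\<close>
      have "\<not> j < nB \<Longrightarrow> (j - nB) mod nA < nA" using j by (cases nA) auto
      then show ?thesis unfolding eq M_def
        using MC(2)[OF i, of j] MD(2)[OF i, of "(j - nB) mod nA"] by (auto simp: le_max_iff_disj)
    qed
    then have rsM: "\<bar>r $ j\<bar> \<le> M" if "r \<in> set ?rs" "j < ?n" for r j using that by auto
    have base: "l1_norm g \<le> ?b" if g: "g \<in> irreducibles ?n (orth ?n R)" for g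
    proof -
      have "g \<in> carrier_vec ?n" using g unfolding irreducibles_def orth_def by blast
      then have "l1_norm g = (\<Sum>j<?n. \<bar>g $ j\<bar>)" unfolding l1_norm_def by simp
      also have "\<dots> \<le> (\<Sum>j<?n. c)"
        using c(2)[OF N g[unfolded R(2)]] by (intro sum_mono) simp
      finally show ?thesis by (simp add: algebra_simps)
    qed
    fix v assume "v \<in> graver_basis ?E"
    then have "v \<in> irreducibles ?n (orth ?n (set ?rs \<union> R))" using R(3) by blast
    from irreducible_norm_insert_rows[OF R(1) rs rsM M0 b0 base this]
    show "l1_norm v \<le> ((\<lambda>k. k * (2 * M * k + 1)) ^^ dC) ?b" by simp
  qed
  moreover have "0 \<le> M" using MC(1) by (simp add: M_def)
  ultimately show ?thesis using c(1) by blast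
qed

theorem theorem2:
  fixes A B C D :: "int mat" and dA nA dC nB :: nat
  assumes "A \<in> carrier_mat dA nA"
    and "B \<in> carrier_mat dA nB"
    and "C \<in> carrier_mat dC nB"
    and "D \<in> carrier_mat dC nA"
  shows "\<exists>p :: real poly. \<forall>N :: nat.
    real_of_int (max_graver_norm (nfold_four_block C D B A N)) \<le> poly p (real N)"
proof -
  let ?m = "\<lambda>N. max_graver_norm (nfold_four_block C D B A N)"
  obtain M c :: int where Mc: "0 \<le> M" "0 \<le> c" and bound: "\<And>N. 0 < N \<Longrightarrow>
      ?m N \<le> ((\<lambda>k. k * (2 * M * k + 1)) ^^ dC) (c * int nB + c * int nA * int N)"
    using max_graver_norm_nfold_le[OF assms] by blast
  obtain p :: "real poly" where p: "\<And>N :: nat. real_of_int (((\<lambda>k. k * (2 * M * k + 1)) ^^ dC)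
      (c * int nB + c * int nA * int N)) = poly p (real N)"
    using funpow_bound_poly[of dC M "c * int nB" "c * int nA"] by blast
  have nonneg: "0 \<le> poly p (real N)" for N
    unfolding p[symmetric] using funpow_bound_nonneg[OF Mc(1), of "c * int nB + c * int nA * int N"] Mc(2)
    by simp
  \<comment> \<open>The added constant covers \<open>N = 0\<close>, where the matrix is
    \<open>C\<close> and the uniform bound does not apply. Since \<open>poly p 0\<close> is
    nonnegative, the constant alone suffices there.\<close>
  have "real_of_int (?m N) \<le> poly (p + [:\<bar>real_of_int (?m 0)\<bar>:]) (real N)" for N
  proof (cases "N = 0")
    case True
    then show ?thesis using nonneg[of 0] by simp
  next
    case False
    then have "real_of_int (?m N) \<le> poly p (real N)" using bound[of N] unfolding p[symmetric] by simp
    then show ?thesis by simp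
  qed
  then show ?thesis by blast
qed

end
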